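(* Let $n=qd$ for positive integers $q,d$, and let $\mathcal{C}=\{X\in\mathbb{S}^n:\operatorname{sbd}(X)=I_n,\ X\succeq0\}$. If $X\in\mathcal{C}$ has rank $p$, then the face $\mathcal{F}_X$ of $\mathcal{C}$ satisfies $$\frac{p(p+1)}{2}-n\frac{d+1}{2}\le\dim\mathcal{F}_X\le\frac{p(p+1)}{2}-p\frac{d+1}{2}.$$ If $p$ is an integer multiple of $d$, the upper bound is attained for some $X\in\mathcal{C}$ of rank $p$.
   Context: $\mathbb{S}^n$: real symmetric $n\times n$ matrices. For $X\in\mathbb{S}^n$ partitioned into $q\times q$ blocks $X_{ij}$ of size $d\times d$, $\operatorname{sbd}(X)$ is the block-diagonal matrix whose diagonal blocks are $X_{ii}$ and whose off-diagonal blocks are zero; thus $\operatorname{sbd}(X)=I_n$ means every diagonal $d\times d$ block of $X$ is $I_d$. A face of the convex set $\mathcal{C}$ is a convex subset $\mathcal{F}\subseteq\mathcal{C}$ such that every closed segment in $\mathcal{C}$ with a relative interior point in $\mathcal{F}$ has both endpoints in $\mathcal{F}$; $\mathcal{F}_X$ is the unique face of $\mathcal{C}$ containing $X$ in its relative interior, and $\dim\mathcal{F}_X$ is the dimension of its affine hull. *)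

theory Defs
  imports "HOL-Analysis.Analysis"
begin

text \<open>Indices of the n x n matrices (n = q d) are pairs (i,k) with i ranging over a
  q-element type 'q (the block index) and k over a d-element type 'd (the position
  inside the block). Thus the (i,j) block of X is the d x d matrix k,l |-> X_(i,k),(j,l).\<close>

type_synonym ('q, 'd) bmat = "real ^ ('q \<times> 'd) ^ ('q \<times> 'd)"

definition symmetric_mat :: "real ^ 'n ^ 'n \<Rightarrow> bool" where
  "symmetric_mat X \<longleftrightarrow> transpose X = X"

definition psd :: "real ^ 'n ^ 'n \<Rightarrow> bool" where
  "psd X \<longleftrightarrow> symmetric_mat X \<and> (\<forall>v. 0 \<le> v \<bullet> (X *v v))"

definition sbd :: "('q::finite, 'd::finite) bmat \<Rightarrow> ('q, 'd) bmat" where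
  "sbd X = (\<chi> a b. if fst a = fst b then X $ a $ b else 0)"

definition elliptope_C :: "('q::finite, 'd::finite) bmat set" where
  "elliptope_C = {X. symmetric_mat X \<and> sbd X = mat 1 \<and> psd X}"

definition face_at :: "'a::euclidean_space set \<Rightarrow> 'a \<Rightarrow> 'a set" where
  "face_at S x = (THE F. F face_of S \<and> x \<in> rel_interior F)"

end

theory Submission
  imports Defs
begin

text \<open>
  Let \<open>V\<close> be the range of \<open>X\<close> and \<open>p = dim V\<close>. The face of \<open>X\<close> consists of the members of the
  elliptope whose kernel contains that of \<open>X\<close>, so its dimension is that of the space \<open>L\<close> of
  symmetric \<open>H\<close> with range in \<open>V\<close> and zero diagonal blocks. Let \<open>W\<^sub>i\<close> be the orthogonal projection
  to \<open>V\<close> of the coordinate subspace of block \<open>i\<close>; since \<open>X\<^sub>i\<^sub>i\<close> is the identity, \<open>dim W\<^sub>i = d\<close>, and the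
  \<open>W\<^sub>i\<close> span \<open>V\<close>. Write \<open>S(W)\<close> for the symmetric matrices with range in \<open>W\<close>, so that
  \<open>dim S(W) = w (w + 1) / 2\<close> for \<open>w = dim W\<close>. Inside \<open>S(V)\<close>, \<open>L\<close> is the orthogonal complement of
  \<open>M\<close>, the sum of the \<open>S(W\<^sub>i)\<close>, and both bounds amount to \<open>p (d + 1) / 2 \<le> dim M \<le> q d (d + 1) / 2\<close>.
  The right one is clear. For the left one, add the \<open>W\<^sub>i\<close> one at a time: if \<open>U\<close> is the sum of the
  previous ones and \<open>k = dim (U \<inter> W\<^sub>i)\<close>, then \<open>dim M\<close> grows by at least
  \<open>dim S(W\<^sub>i) - dim S(U \<inter> W\<^sub>i) = (d (d + 1) - k (k + 1)) / 2 \<ge> (d - k) (d + 1) / 2\<close> while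
  \<open>dim U\<close> grows by \<open>d - k\<close>. For \<open>p = m d\<close> equality holds when all the blocks \<open>X\<^sub>i\<^sub>j\<close> are \<open>I\<close> or \<open>0\<close>
  according to a partition of the block indices into \<open>m\<close> classes, since then only \<open>m\<close> of the \<open>W\<^sub>i\<close>
  are distinct.
\<close>

subsection \<open>Symmetric matrices with range in a subspace\<close>

definition outer :: "real ^ 'n \<Rightarrow> real ^ 'n \<Rightarrow> real ^ 'n ^ 'n" where
  "outer x y = (\<chi> i j. x $ i * y $ j)"

text \<open>By symmetry such an \<open>A\<close> also vanishes on the orthogonal complement of
  \<open>W\<close>, so it amounts to a quadratic form on \<open>W\<close>.\<close>

definition sym_range :: "(real ^ 'n) set \<Rightarrow> (real ^ 'n ^ 'n) set" where
  "sym_range W = {A. symmetric_mat A \<and> (\<forall>v. A *v v \<in> W)}"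

lemma matrix_vector_mult_scaleR_left: "(c *\<^sub>R A) *v x = c *\<^sub>R (A *v x)"
  for A :: "real ^ 'n ^ 'm"
  by (simp add: matrix_vector_mult_def vec_eq_iff sum_distrib_left mult.assoc)

lemma inner_matrix_vector: "x \<bullet> (A *v y) = (\<Sum>i\<in>UNIV. \<Sum>j\<in>UNIV. x $ i * A $ i $ j * y $ j)"
  for A :: "real ^ 'n ^ 'm"
  by (simp add: inner_vec_def matrix_vector_mult_def sum_distrib_left mult.assoc)

lemma symmetric_mat_iff: "symmetric_mat A \<longleftrightarrow> (\<forall>x y. x \<bullet> (A *v y) = (A *v x) \<bullet> y)"
  for A :: "real ^ 'n ^ 'n"
proof
  assume "symmetric_mat A"
  then show "\<forall>x y. x \<bullet> (A *v y) = (A *v x) \<bullet> y"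
    by (metis symmetric_mat_def dot_lmul_matrix vector_transpose_matrix)
next
  assume *: "\<forall>x y. x \<bullet> (A *v y) = (A *v x) \<bullet> y"
  have "A $ i $ j = A $ j $ i" for i j
    using *[rule_format, of "axis i 1" "axis j 1"]
    by (simp add: inner_axis' inner_axis matrix_vector_mult_basis column_def)
  then show "symmetric_mat A"
    by (simp add: symmetric_mat_def transpose_def vec_eq_iff)
qed

lemma outer_mult_vec: "outer x y *v v = (y \<bullet> v) *\<^sub>R x"
  by (simp add: outer_def matrix_vector_mult_def vec_eq_iff inner_vec_def
      sum_distrib_left mult_ac)

text \<open>This turns orthogonality of matrices into vanishing of bilinear forms.\<close>

lemma inner_outer: "outer x y \<bullet> A = x \<bullet> (A *v y)"
  unfolding inner_matrix_vector
  by (simp add: outer_def inner_vec_def mult_ac)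

lemma symmetric_outer: "symmetric_mat (outer x y + outer y x)"
  unfolding symmetric_mat_iff
  by (simp add: matrix_vector_mult_add_rdistrib outer_mult_vec inner_add_left inner_add_right
      inner_commute mult.commute)

lemma subspace_sym_range:
  assumes "subspace W"
  shows "subspace (sym_range W)"
  using assms
  by (auto simp: subspace_def sym_range_def symmetric_mat_iff matrix_vector_mult_add_rdistrib
      matrix_vector_mult_scaleR_left inner_add_left inner_add_right)

lemma sym_range_Int: "sym_range (U \<inter> W) = sym_range U \<inter> sym_range W"
  by (auto simp: sym_range_def)

lemma sym_range_mono: "U \<subseteq> W \<Longrightarrow> sym_range U \<subseteq> sym_range W"
  by (auto simp: sym_range_def)

lemma outer_in_sym_range:
  assumes "subspace W" "x \<in> W" "y \<in> W"
  shows "outer x y + outer y x \<in> sym_range W"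
  using assms
  by (auto simp: sym_range_def symmetric_outer matrix_vector_mult_add_rdistrib outer_mult_vec
      subspace_add subspace_scale)

text \<open>In an orthonormal basis of \<open>W\<close> starting with \<open>x\<close>, the vector
  \<open>y\<close> collects the row and column of \<open>A\<close> belonging to \<open>x\<close>,
  and \<open>B\<close> is the rest.\<close>

lemma sym_range_decomp:
  fixes x :: "real ^ 'n"
  assumes W: "subspace W" and x: "x \<in> W" "norm x = 1" and A: "A \<in> sym_range W"
  obtains B y where "B \<in> sym_range {w \<in> W. x \<bullet> w = 0}" "y \<in> W" "A = B + (outer x y + outer y x)"
proof -
  have xx: "x \<bullet> x = 1"
    using x by (simp add: dot_square_norm)
  define y where "y = A *v x - ((x \<bullet> (A *v x)) / 2) *\<^sub>R x"
  \<comment> \<open>The symmetrized product counts the diagonal entry at \<open>x\<close> twice,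
    hence the half in \<open>y\<close>.\<close>
  have y: "y \<in> W"
    using A W x by (auto simp: y_def sym_range_def intro!: subspace_diff subspace_scale)
  have sA: "u \<bullet> (A *v v) = (A *v u) \<bullet> v" for u v
    using A by (simp add: sym_range_def symmetric_mat_iff)
  have "A - (outer x y + outer y x) \<in> sym_range W"
    by (intro subspace_diff subspace_sym_range W A outer_in_sym_range x y)
  moreover have "x \<bullet> ((A - (outer x y + outer y x)) *v v) = 0" for v
    by (simp add: matrix_vector_mult_add_rdistrib matrix_vector_mult_diff_rdistrib outer_mult_vec
        y_def inner_add_left inner_add_right inner_diff_left inner_diff_right xx sA)
  ultimately have "A - (outer x y + outer y x) \<in> sym_range {w \<in> W. x \<bullet> w = 0}"
    by (simp add: sym_range_def)
  from that[OF this y] show thesis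
    by simp
qed

text \<open>Induction on the dimension: splitting off a unit vector \<open>x\<close> leaves S(W')
  for its complement \<open>W'\<close> in \<open>W\<close> and a copy of \<open>W\<close>, so the
  dimension grows by \<open>dim W\<close>.\<close>

lemma dim_sym_range:
  fixes W :: "(real ^ 'n) set"
  assumes "subspace W"
  shows "2 * dim (sym_range W) = dim W * (dim W + 1)"
  using assms
proof (induction "dim W" arbitrary: W)
  case 0
  then have "W = {0}"
    by (metis dim_eq_0 subspace_0 subset_singletonD empty_iff)
  then have "sym_range W \<subseteq> {0}"
    by (auto simp: sym_range_def matrix_eq)
  then show ?case
    using dim_eq_0[of "sym_range W"] \<open>W = {0}\<close> by simp
next
  case (Suc n)
  obtain x where x: "x \<in> W" "norm x = 1"
  proof -
    have "\<not> W \<subseteq> {0}"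
      using Suc by (metis dim_eq_0 nat.distinct(1))
    then obtain z where "z \<in> W" "z \<noteq> 0"
      by blast
    then show thesis
      using Suc that[of "z /\<^sub>R norm z"] by (simp add: subspace_scale)
  qed
  define W' where "W' = {w \<in> W. x \<bullet> w = 0}"
  define f where "f y = outer x y + outer y x" for y
  have W': "subspace W'"
    using Suc.prems by (auto simp: W'_def subspace_def inner_add_right)
  have "dim {y \<in> W. \<forall>u \<in> span {x}. orthogonal u y} + dim (span {x}) = dim W"
    using x Suc.prems by (intro dim_subspace_orthogonal_to_vectors) (auto simp: span_minimal)
  moreover have "{y \<in> W. \<forall>u \<in> span {x}. orthogonal u y} = W'"
    by (auto simp: W'_def orthogonal_def span_singleton)
  moreover have "dim (span {x}) = 1"
    using x by (auto simp: dim_span dim_insert)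
  ultimately have dW': "dim W' = n"
    using Suc.hyps by simp
  have lf: "linear f"
    by (auto simp: f_def linear_iff outer_def vec_eq_iff algebra_simps)
  \<comment> \<open>Evaluating the form at \<open>x\<close> and \<open>y\<close> gives |y|^2 + (x .
    y)^2 = 0. This yields both the injectivity of \<open>f\<close> and the directness of the sum
    below.\<close>
  have only0: "y = 0" if "f y \<in> sym_range W'" for y
  proof -
    have "x \<bullet> (f y *v y) = 0"
      using that by (simp add: sym_range_def W'_def)
    then have "(y \<bullet> y) * (x \<bullet> x) + (x \<bullet> y) * (x \<bullet> y) = 0"
      by (simp add: f_def matrix_vector_mult_add_rdistrib outer_mult_vec inner_add_right)
    then have "y \<bullet> y + (x \<bullet> y)\<^sup>2 = 0"
      using x by (simp add: dot_square_norm power2_eq_square)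
    then show ?thesis
      by (metis inner_ge_zero zero_le_power2 add_nonneg_eq_0_iff inner_eq_zero_iff)
  qed
  have injf: "inj f"
    using only0 W' linear_injective_0[OF lf] subspace_0[OF subspace_sym_range[OF W']] by metis
  have dfW: "dim (f ` W) = dim W"
    using injf by (intro dim_image_eq lf) (auto intro: inj_on_subset)
  have "sym_range W = {a + b |a b. a \<in> sym_range W' \<and> b \<in> f ` W}" (is "_ = ?R")
  proof
    show "sym_range W \<subseteq> ?R"
    proof
      fix A assume "A \<in> sym_range W"
      from sym_range_decomp[OF Suc.prems x this] show "A \<in> ?R"
        unfolding W'_def f_def by (smt (verit, best) image_eqI mem_Collect_eq)
    qed
    show "?R \<subseteq> sym_range W"
      using Suc.prems x sym_range_mono[of W' W]
      by (auto simp: W'_def f_def intro!: subspace_add[OF subspace_sym_range] outer_in_sym_range)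
  qed
  moreover have "sym_range W' \<inter> f ` W = {0}"
    using only0 subspace_0[OF Suc.prems] subspace_0[OF subspace_sym_range[OF W']] linear_0[OF lf]
    by (auto simp: image_iff)
  ultimately have "dim (sym_range W) = dim (sym_range W') + dim W"
    using dim_sums_Int[OF subspace_sym_range[OF W'] linear_subspace_image[OF lf Suc.prems]] dfW
    by simp
  moreover have "2 * dim (sym_range W') = n * (n + 1)"
    using Suc.hyps(1)[of W'] dW' W' by simp
  ultimately show ?case
    unfolding Suc.hyps(2)[symmetric] by simp
qed

lemma orthonormal_basis_of_subspace:
  fixes W :: "'a::euclidean_space set"
  assumes "subspace W"
  obtains B where "finite B" "B \<subseteq> W" "\<And>x. x \<in> W \<Longrightarrow> (\<Sum>b\<in>B. (x \<bullet> b) *\<^sub>R b) = x"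
proof -
  obtain B where B: "B \<subseteq> W" "pairwise orthogonal B" "\<And>x. x \<in> B \<Longrightarrow> norm x = 1"
    "independent B" "card B = dim W" "span B = W"
    using orthonormal_basis_subspace[OF assms] by metis
  then have "finite B"
    using independent_imp_finite by blast
  then show thesis
    using B by (intro that) (auto intro: orthonormal_basis_expand)
qed

text \<open>One direction tests with symmetrized rank-one matrices. For the other, an orthonormal
  basis \<open>B\<close> of \<open>W\<close> writes \<open>A\<close> as the sum of
  \<open>outer b (A *v b)\<close>, whose factors lie in \<open>W\<close>.\<close>

lemma orthogonal_sym_range_iff:
  fixes H :: "real ^ 'n ^ 'n"
  assumes W: "subspace W" and H: "symmetric_mat H"
  shows "(\<forall>A\<in>sym_range W. orthogonal A H) \<longleftrightarrow> (\<forall>x\<in>W. \<forall>y\<in>W. x \<bullet> (H *v y) = 0)"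
proof (intro iffI ballI)
  fix x y assume *: "\<forall>A\<in>sym_range W. orthogonal A H" and "x \<in> W" "y \<in> W"
  then have "orthogonal (outer x y + outer y x) H"
    using W outer_in_sym_range by blast
  then have "x \<bullet> (H *v y) + y \<bullet> (H *v x) = 0"
    by (simp add: orthogonal_def inner_add_left inner_outer)
  then show "x \<bullet> (H *v y) = 0"
    using H by (simp add: symmetric_mat_iff inner_commute)
next
  fix A assume *: "\<forall>x\<in>W. \<forall>y\<in>W. x \<bullet> (H *v y) = 0" and A: "A \<in> sym_range W"
  obtain B where B: "finite B" "B \<subseteq> W" "\<And>x. x \<in> W \<Longrightarrow> (\<Sum>b\<in>B. (x \<bullet> b) *\<^sub>R b) = x"
    using orthonormal_basis_of_subspace[OF W] by metis
  have "A *v v = (\<Sum>b\<in>B. outer b (A *v b)) *v v" for v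
  proof -
    have "A *v v = (\<Sum>b\<in>B. ((A *v v) \<bullet> b) *\<^sub>R b)"
      using A B(3)[of "A *v v"] by (simp add: sym_range_def)
    also have "\<dots> = (\<Sum>b\<in>B. outer b (A *v b) *v v)"
      using A by (intro sum.cong) (auto simp: outer_mult_vec sym_range_def symmetric_mat_iff inner_commute)
    also have "\<dots> = (\<Sum>b\<in>B. outer b (A *v b)) *v v"
      using B(1) by (induction B rule: finite_induct) (simp_all add: matrix_vector_mult_add_rdistrib)
    finally show ?thesis .
  qed
  then have "A = (\<Sum>b\<in>B. outer b (A *v b))"
    unfolding matrix_eq by blast
  then have "A \<bullet> H = (\<Sum>b\<in>B. outer b (A *v b)) \<bullet> H"
    by (rule arg_cong[where f = "\<lambda>C. C \<bullet> H"])
  also have "\<dots> = (\<Sum>b\<in>B. b \<bullet> (H *v (A *v b)))"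
    by (simp add: inner_sum_left inner_outer)
  also have "\<dots> = 0"
    using * A B by (auto intro!: sum.neutral simp: sym_range_def)
  finally show "orthogonal A H"
    by (simp add: orthogonal_def)
qed

text \<open>Subadditivity of the dimension, one summand at a time.\<close>

lemma dim_span_UN_sym_range_le:
  assumes "finite I" and "\<And>i. i \<in> I \<Longrightarrow> subspace (W i)" and "\<And>i. i \<in> I \<Longrightarrow> dim (W i) = d"
  shows "2 * dim (span (\<Union>i\<in>I. sym_range (W i))) \<le> card I * (d * (d + 1))"
  using assms
proof (induction rule: finite_induct)
  case (insert j J)
  let ?T = "span (\<Union>i\<in>J. sym_range (W i))" and ?S = "sym_range (W j)"
  have "span (\<Union>i\<in>insert j J. sym_range (W i)) = {x + y |x y. x \<in> ?S \<and> y \<in> ?T}"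
    using insert.prems by (simp add: span_Un subspace_sym_range span_eq_iff[THEN iffD2])
  then have "dim (span (\<Union>i\<in>insert j J. sym_range (W i))) + dim (?S \<inter> ?T) = dim ?S + dim ?T"
    using insert.prems by (simp add: dim_sums_Int subspace_sym_range del: dim_span)
  moreover have "2 * dim ?S = d * (d + 1)"
    using insert.prems dim_sym_range[of "W j"] by simp
  moreover have "2 * dim ?T \<le> card J * (d * (d + 1))"
    using insert by blast
  ultimately show ?case
    using insert.hyps by (simp add: algebra_simps)
qed simp

lemma dim_span_UN_sym_range_ge:
  assumes "finite I" and "\<And>i. i \<in> I \<Longrightarrow> subspace (W i)" and "\<And>i. i \<in> I \<Longrightarrow> dim (W i) = d"
  shows "dim (span (\<Union>i\<in>I. W i)) * (d + 1) \<le> 2 * dim (span (\<Union>i\<in>I. sym_range (W i)))"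
  using assms
proof (induction rule: finite_induct)
  case (insert j J)
  let ?T = "span (\<Union>i\<in>J. sym_range (W i))" and ?S = "sym_range (W j)"
  let ?U = "span (\<Union>i\<in>J. W i)"
  define k where "k = dim (W j \<inter> ?U)"
  have Wj: "subspace (W j)" "dim (W j) = d"
    using insert.prems by auto
  have "span (\<Union>i\<in>insert j J. sym_range (W i)) = {x + y |x y. x \<in> ?S \<and> y \<in> ?T}"
    using Wj by (simp add: span_Un subspace_sym_range span_eq_iff[THEN iffD2])
  then have 1: "dim (span (\<Union>i\<in>insert j J. sym_range (W i))) + dim (?S \<inter> ?T) = dim ?S + dim ?T"
    using Wj by (simp add: dim_sums_Int subspace_sym_range del: dim_span)
  have "span (\<Union>i\<in>insert j J. W i) = {x + y |x y. x \<in> W j \<and> y \<in> ?U}"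
    using Wj by (simp add: span_Un span_eq_iff[THEN iffD2])
  then have 2: "dim (span (\<Union>i\<in>insert j J. W i)) + k = d + dim ?U"
    using Wj by (simp add: dim_sums_Int k_def del: dim_span)
  \<comment> \<open>Members of \<open>?T\<close> have range in \<open>?U\<close>, so the overlap of
    \<open>?S\<close> and \<open>?T\<close> is controlled by the overlap of \<open>W j\<close> and
    \<open>?U\<close>.\<close>
  have "?T \<subseteq> sym_range ?U"
    using sym_range_mono[of "W _" ?U]
    by (intro span_minimal subspace_sym_range) (auto intro: span_base sym_range_mono[THEN subsetD])
  then have "dim (?S \<inter> ?T) \<le> dim (sym_range (W j \<inter> ?U))"
    by (intro dim_subset) (auto simp: sym_range_Int)
  then have 3: "2 * dim (?S \<inter> ?T) \<le> k * (k + 1)"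
    using dim_sym_range[of "W j \<inter> ?U"] Wj by (simp add: k_def subspace_Int subspace_inter)
  have 4: "2 * dim ?S = d * (d + 1)"
    using Wj dim_sym_range[of "W j"] by simp
  have 5: "dim ?U * (d + 1) \<le> 2 * dim ?T"
    using insert by blast
  have "k \<le> d"
    unfolding k_def Wj(2)[symmetric] by (intro dim_subset) auto
  \<comment> \<open>This coarser bound is linear in \<open>k\<close>, as is the dimension formula
    for the new span, so the overlap terms cancel.\<close>
  then have "k * (k + 1) \<le> k * (d + 1)"
    by simp
  moreover have "dim (span (\<Union>i\<in>insert j J. W i)) * (d + 1) + k * (d + 1) = d * (d + 1) + dim ?U * (d + 1)"
    using 2 by (metis add_mult_distrib)
  ultimately show ?case
    using 1 3 4 5 by linarith
qed simp

subsection \<open>Projected coordinate blocks\<close>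

lemma orthogonal_projection_obtain:
  fixes V :: "'a::euclidean_space set"
  assumes "subspace V"
  obtains f where "linear f" "\<And>v. f v \<in> V" "\<And>u v. u \<in> V \<Longrightarrow> u \<bullet> f v = u \<bullet> v"
    "\<And>u. u \<in> V \<Longrightarrow> f u = u"
proof -
  obtain B where B: "finite B" "B \<subseteq> V" "\<And>x. x \<in> V \<Longrightarrow> (\<Sum>b\<in>B. (x \<bullet> b) *\<^sub>R b) = x"
    using orthonormal_basis_of_subspace[OF assms] by metis
  define f where "f v = (\<Sum>b\<in>B. (v \<bullet> b) *\<^sub>R b)" for v
  have "u \<bullet> f v = u \<bullet> v" if "u \<in> V" for u v
  proof -
    have "u \<bullet> f v = (\<Sum>b\<in>B. (u \<bullet> b) *\<^sub>R b) \<bullet> v"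
      by (simp add: f_def inner_sum_left inner_sum_right inner_commute mult.commute)
    then show ?thesis
      using B that by simp
  qed
  moreover have "linear f"
    by (auto simp: f_def linear_iff inner_add_left scaleR_add_left sum.distrib scaleR_sum_right)
  moreover have "f v \<in> V" for v
    using B assms by (auto simp: f_def intro!: subspace_sum subspace_scale)
  ultimately show thesis
    using B that[of f] by (auto simp: f_def)
qed

text \<open>The isometric inclusion of R^d as the coordinate subspace of block \<open>i\<close>;
  restricting a form to it picks out the diagonal block \<open>i\<close>.\<close>

definition block_emb :: "'q \<Rightarrow> real ^ 'd \<Rightarrow> real ^ ('q::finite \<times> 'd::finite)" where
  "block_emb i x = (\<chi> a. if fst a = i then x $ snd a else 0)"

lemma linear_block_emb: "linear (block_emb i)"
  by (auto simp: block_emb_def linear_iff vec_eq_iff)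

lemma block_emb_axis: "block_emb i (axis k c) = axis (i, k) c"
  by (auto simp: block_emb_def axis_def vec_eq_iff)

lemma sum_block_emb: "(\<Sum>b\<in>UNIV. c b * block_emb i x $ b) = (\<Sum>k\<in>UNIV. c (i, k) * x $ k)"
proof -
  have "(\<Sum>b\<in>UNIV. c b * block_emb i x $ b)
      = (\<Sum>j\<in>UNIV. \<Sum>k\<in>UNIV. if j = i then c (i, k) * x $ k else 0)"
    unfolding UNIV_Times_UNIV[symmetric] sum.cartesian_product
    by (intro sum.cong) (auto simp: block_emb_def)
  also have "\<dots> = (\<Sum>k\<in>UNIV. \<Sum>j\<in>UNIV. if j = i then c (i, k) * x $ k else 0)"
    by (rule sum.swap)
  finally show ?thesis
    by simp
qed

lemma matrix_mult_block_emb: "(A *v block_emb i x) $ a = (\<Sum>k\<in>UNIV. A $ a $ (i, k) * x $ k)"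
  by (simp add: matrix_vector_mult_def sum_block_emb)

lemma inner_block_emb: "v \<bullet> block_emb i x = (\<Sum>k\<in>UNIV. v $ (i, k) * x $ k)"
  by (simp add: inner_vec_def sum_block_emb)

lemma quadratic_form_block_emb:
  "block_emb i x \<bullet> (A *v block_emb i y) = (\<Sum>k\<in>UNIV. \<Sum>l\<in>UNIV. x $ k * A $ (i, k) $ (i, l) * y $ l)"
  by (subst inner_commute)
    (simp add: inner_block_emb matrix_mult_block_emb sum_distrib_right sum_distrib_left mult_ac)

lemma sum_UNIV_block_emb: "(\<Sum>i\<in>UNIV. block_emb i (\<chi> k. v $ (i, k))) = v"
proof -
  have "(\<Sum>i\<in>UNIV. if fst a = i then v $ (i, snd a) else 0) = v $ a" for a
    by simp
  then show ?thesis
    by (simp add: vec_eq_iff sum_component block_emb_def)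
qed

lemma sbd_eq_iff: "sbd X = mat 1 \<longleftrightarrow> (\<forall>i k l. X $ (i, k) $ (i, l) = (if k = l then 1 else 0))"
  by (auto simp: sbd_def mat_def vec_eq_iff)

text \<open>A coordinate-free version of the block condition, which can be transported along the
  projection to the range of \<open>X\<close>.\<close>

lemma sbd_eq_0_iff:
  "sbd H = 0 \<longleftrightarrow> (\<forall>i x y. block_emb i x \<bullet> (H *v block_emb i y) = 0)"
proof -
  have "sbd H = 0 \<longleftrightarrow> (\<forall>i k l. H $ (i, k) $ (i, l) = 0)"
    by (auto simp: sbd_def vec_eq_iff)
  also have "\<dots> \<longleftrightarrow> (\<forall>i x y. block_emb i x \<bullet> (H *v block_emb i y) = 0)"
  proof (intro iffI allI)
    fix i k l assume "\<forall>i x y. block_emb i x \<bullet> (H *v block_emb i y) = 0"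
    then have "block_emb i (axis k 1) \<bullet> (H *v block_emb i (axis l 1)) = 0"
      by blast
    then show "H $ (i, k) $ (i, l) = 0"
      by (simp add: block_emb_axis inner_axis' matrix_vector_mult_basis column_def)
  qed (simp add: quadratic_form_block_emb)
  finally show ?thesis .
qed

text \<open>In particular no nonzero vector of a coordinate block is in the kernel of
  \<open>X\<close>.\<close>

lemma inner_block_emb_elliptope:
  assumes "X \<in> elliptope_C"
  shows "block_emb i x \<bullet> (X *v block_emb i y) = x \<bullet> y"
proof -
  have "X $ (i, k) $ (i, l) = (if k = l then 1 else 0)" for k l
    using assms by (simp add: elliptope_C_def sbd_eq_iff)
  then have "x $ k * X $ (i, k) $ (i, l) * y $ l = (if k = l then x $ k * y $ l else 0)" for k l
    by simp
  then have "block_emb i x \<bullet> (X *v block_emb i y) = (\<Sum>k\<in>UNIV. \<Sum>l\<in>UNIV. if k = l then x $ k * y $ l else 0)"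
    unfolding quadratic_form_block_emb by presburger
  then show ?thesis
    by (simp add: inner_vec_def)
qed

lemma subspace_range_matrix: "subspace (range ((*v) A))" for A :: "real ^ 'n ^ 'm"
  by (simp add: linear_subspace_image)

text \<open>The space L: the directions in which \<open>X\<close> can move inside its face.\<close>

definition face_dir :: "('q::finite, 'd::finite) bmat \<Rightarrow> ('q, 'd) bmat set" where
  "face_dir X = {H \<in> sym_range (range ((*v) X)). sbd H = 0}"

text \<open>The projection \<open>f\<close> to the range and \<open>X\<close> itself have the same
  kernel. So the dimension of \<open>W i\<close>, and the coincidence of these spaces for blocks
  with equal columns, can be checked on \<open>X\<close>.\<close>

lemma face_dir_complement:
  fixes X :: "('q::finite, 'd::finite) bmat"
  assumes X: "X \<in> elliptope_C"
  obtains W :: "'q \<Rightarrow> (real ^ ('q \<times> 'd)) set"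
  where "\<And>i. subspace (W i)" "\<And>i. dim (W i) = CARD('d)" "span (\<Union>i. W i) = range ((*v) X)"
    "dim (face_dir X) + dim (span (\<Union>i. sym_range (W i))) = dim (sym_range (range ((*v) X)))"
    "\<And>i j. (\<forall>k. column (i, k) X = column (j, k) X) \<Longrightarrow> W i = W j"
proof -
  define V where "V = range ((*v) X)"
  have V: "subspace V"
    by (simp add: V_def subspace_range_matrix)
  have symX: "u \<bullet> (X *v v) = (X *v u) \<bullet> v" for u v
    using X by (simp add: elliptope_C_def symmetric_mat_iff)
  obtain f where lf: "linear f" and fV: "\<And>v. f v \<in> V"
    and f_inner: "\<And>u v. u \<in> V \<Longrightarrow> u \<bullet> f v = u \<bullet> v" and f_id: "\<And>u. u \<in> V \<Longrightarrow> f u = u"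
    using orthogonal_projection_obtain[OF V] by metis
  have f_eq_0: "f v = 0 \<longleftrightarrow> X *v v = 0" for v
  proof
    assume "f v = 0"
    then have "(X *v (X *v v)) \<bullet> v = 0"
      using f_inner[of "X *v (X *v v)" v] by (simp add: V_def)
    then have "(X *v v) \<bullet> (X *v v) = 0"
      by (metis symX)
    then show "X *v v = 0"
      by simp
  next
    assume *: "X *v v = 0"
    obtain w where "f v = X *v w"
      using fV[of v] by (auto simp: V_def)
    then have "f v \<bullet> f v = w \<bullet> (X *v v)"
      by (metis f_inner[OF fV] symX)
    then show "f v = 0"
      using * by simp
  qed
  have f_eq: "f v = f w \<longleftrightarrow> X *v v = X *v w" for v w
    using f_eq_0[of "v - w"] by (simp add: linear_diff[OF lf] matrix_vector_mult_diff_distrib)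
  define g where "g i x = f (block_emb i x)" for i x
  have lg: "linear (g i)" for i
    unfolding g_def using linear_compose[OF linear_block_emb lf] by (simp add: o_def)
  define W where "W i = range (g i)" for i
  have subW: "subspace (W i)" for i
    by (simp add: W_def lg linear_subspace_image)
  have dimW: "dim (W i) = CARD('d)" for i
  proof -
    have "x = 0" if "g i x = 0" for x
    proof -
      have "x \<bullet> x = block_emb i x \<bullet> (X *v block_emb i x)"
        by (simp add: inner_block_emb_elliptope[OF X])
      then show ?thesis
        using that by (simp add: g_def f_eq_0)
    qed
    then have "inj (g i)"
      using linear_injective_0[OF lg] by blast
    then show ?thesis
      by (simp add: W_def dim_image_eq[OF lg])
  qed
  have spanW: "span (\<Union>i. W i) = V"
  proof
    show "span (\<Union>i. W i) \<subseteq> V"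
      by (intro span_minimal V) (auto simp: W_def g_def fV)
    show "V \<subseteq> span (\<Union>i. W i)"
    proof
      fix u assume "u \<in> V"
      then have "u = f (\<Sum>i\<in>UNIV. block_emb i (\<chi> k. u $ (i, k)))"
        by (simp add: f_id sum_UNIV_block_emb)
      also have "\<dots> = (\<Sum>i\<in>UNIV. g i (\<chi> k. u $ (i, k)))"
        by (simp add: g_def linear_sum[OF lf])
      also have "\<dots> \<in> span (\<Union>i. W i)"
        by (intro span_sum span_base) (auto simp: W_def)
      finally show "u \<in> span (\<Union>i. W i)" .
    qed
  qed
  let ?M = "span (\<Union>i. sym_range (W i))"
  have M_sub: "?M \<subseteq> sym_range V"
    using spanW by (intro span_minimal subspace_sym_range V UN_least sym_range_mono)
      (auto intro: span_base)
  have "face_dir X = {H \<in> sym_range V. \<forall>A\<in>?M. orthogonal A H}"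
  proof -
    have "sbd H = 0 \<longleftrightarrow> (\<forall>A\<in>?M. orthogonal A H)" if H: "H \<in> sym_range V" for H
    proof -
      have symH: "symmetric_mat H" and symH': "u \<bullet> (H *v v) = (H *v u) \<bullet> v"
        and HV: "H *v v \<in> V" for u v
        using H by (simp_all add: sym_range_def symmetric_mat_iff)
      \<comment> \<open>As \<open>H\<close> is symmetric with range in \<open>V\<close>, projecting
        its arguments leaves the form unchanged; the condition on coordinate blocks becomes one on
        the \<open>W i\<close>.\<close>
      have "f u \<bullet> (H *v f v) = u \<bullet> (H *v v)" for u v
        by (metis HV f_inner inner_commute symH')
      then have "sbd H = 0 \<longleftrightarrow> (\<forall>i. \<forall>x\<in>W i. \<forall>y\<in>W i. x \<bullet> (H *v y) = 0)"
        by (simp add: sbd_eq_0_iff W_def g_def)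
      also have "\<dots> \<longleftrightarrow> (\<forall>A\<in>(\<Union>i. sym_range (W i)). orthogonal A H)"
        using orthogonal_sym_range_iff[OF subW symH] by auto
      also have "\<dots> \<longleftrightarrow> (\<forall>A\<in>?M. orthogonal A H)"
        by (meson orthogonal_commute orthogonal_to_span span_base)
      finally show ?thesis .
    qed
    then show ?thesis
      by (auto simp: face_dir_def V_def)
  qed
  then have "dim (face_dir X) + dim ?M = dim (sym_range V)"
    using dim_subspace_orthogonal_to_vectors[OF subspace_span subspace_sym_range[OF V] M_sub] by simp
  moreover have "W i = W j" if "\<forall>k. column (i, k) X = column (j, k) X" for i j
  proof -
    have "X $ a $ (i, k) = X $ a $ (j, k)" for a k
      using that by (cases a) (simp add: column_def vec_eq_iff)
    then have "X *v block_emb i x = X *v block_emb j x" for x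
      by (simp add: vec_eq_iff matrix_mult_block_emb)
    then have "g i = g j"
      by (intro ext) (simp only: g_def f_eq)
    then show ?thesis
      by (simp add: W_def)
  qed
  ultimately show thesis
    using that[of W] subW dimW spanW by (simp add: V_def)
qed

subsection \<open>Faces of the elliptope\<close>

text \<open>Otherwise the form is negative at \<open>v + t *\<^sub>R w\<close> for a small negative
  \<open>t\<close>, where the linear term in \<open>t\<close> dominates.\<close>

lemma psd_mult_eq_0:
  assumes "psd A" "v \<bullet> (A *v v) = 0"
  shows "A *v v = 0"
proof (rule ccontr)
  define w where "w = A *v v"
  define c where "c = w \<bullet> (A *v w)"
  assume "A *v v \<noteq> 0"
  then have w: "0 < w \<bullet> w"
    by (simp add: w_def)
  have c: "0 \<le> c"
    using assms by (simp add: c_def psd_def)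
  \<comment> \<open>The denominator \<open>c + 1\<close> is positive even when \<open>c\<close> is
    zero.\<close>
  define t where "t = - (w \<bullet> w) / (c + 1)"
  have sA: "x \<bullet> (A *v y) = (A *v x) \<bullet> y" for x y
    using assms by (simp add: psd_def symmetric_mat_iff)
  have "0 \<le> (v + t *\<^sub>R w) \<bullet> (A *v (v + t *\<^sub>R w))"
    using assms by (simp add: psd_def)
  also have "\<dots> = 2 * t * (w \<bullet> w) + t\<^sup>2 * c"
    using assms(2) sA[of v w]
    by (simp add: matrix_vector_right_distrib matrix_vector_mult_scaleR inner_add_left inner_add_right
        power2_eq_square algebra_simps flip: w_def c_def)
  also have "\<dots> \<le> 2 * t * (w \<bullet> w) + t\<^sup>2 * (c + 1)"
    by (simp add: mult_left_mono)
  also have "\<dots> = t * (w \<bullet> w)"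
  proof -
    have "t * (c + 1) = - (w \<bullet> w)"
      using c by (simp add: t_def)
    then show ?thesis
      by (simp add: power2_eq_square mult.assoc)
  qed
  also have "\<dots> < 0"
    using w c by (simp add: t_def divide_neg_pos mult_neg_pos)
  finally show False
    by simp
qed

text \<open>The norm of \<open>A\<close> is the Euclidean norm of its entries, so Cauchy-Schwarz on
  each row suffices.\<close>

lemma norm_matrix_vector_mult_le: "norm (A *v x) \<le> norm A * norm x" for A :: "real ^ 'n ^ 'm"
proof -
  have "norm (A *v x) = L2_set (\<lambda>i. norm (A $ i \<bullet> x)) UNIV"
    by (simp add: norm_vec_def[of "A *v x"] matrix_vector_mul_component)
  also have "\<dots> \<le> L2_set (\<lambda>i. norm (A $ i) * norm x) UNIV"
    by (intro L2_set_mono) (auto simp: Cauchy_Schwarz_ineq2)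
  also have "\<dots> = norm A * norm x"
    by (simp add: L2_set_left_distrib norm_vec_def[of A])
  finally show ?thesis .
qed

text \<open>Kernel and range of \<open>X\<close> are orthogonal, so the form is positive on nonzero
  vectors of the range; compactness of the unit sphere makes this uniform.\<close>

lemma psd_pos_on_range:
  fixes X :: "real ^ 'n ^ 'n"
  assumes "psd X"
  obtains c where "c > 0" "\<And>v. v \<in> range ((*v) X) \<Longrightarrow> c * (norm v)\<^sup>2 \<le> v \<bullet> (X *v v)"
proof -
  define V where "V = range ((*v) X)"
  define S where "S = V \<inter> sphere 0 1"
  have sX: "x \<bullet> (X *v y) = (X *v x) \<bullet> y" for x y
    using assms by (simp add: psd_def symmetric_mat_iff)
  have V: "subspace V"
    by (simp add: V_def subspace_range_matrix)
  have pos: "0 < v \<bullet> (X *v v)" if v: "v \<in> V" "v \<noteq> 0" for v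
  proof (rule ccontr)
    assume "\<not> 0 < v \<bullet> (X *v v)"
    then have "X *v v = 0"
      using assms by (intro psd_mult_eq_0) (auto simp: psd_def not_less intro: antisym)
    moreover obtain w where "v = X *v w"
      using v unfolding V_def by blast
    ultimately have "v \<bullet> v = 0"
      by (metis sX inner_zero_left)
    then show False
      using that by simp
  qed
  have "\<exists>c>0. \<forall>v\<in>S. c \<le> v \<bullet> (X *v v)"
  proof (cases "S = {}")
    case False
    have "compact S"
      unfolding S_def by (simp add: V closed_subspace closed_Int_compact)
    moreover have "continuous_on S (\<lambda>v. v \<bullet> (X *v v))"
      by (intro continuous_intros)
    ultimately obtain u where u: "u \<in> S" "\<forall>v\<in>S. u \<bullet> (X *v u) \<le> v \<bullet> (X *v v)"
      using continuous_attains_inf[OF _ False] by blast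
    moreover have "0 < u \<bullet> (X *v u)"
      using u(1) by (intro pos) (auto simp: S_def)
    ultimately show ?thesis
      by blast
  \<comment> \<open>Without unit vectors in the range, any positive constant serves.\<close>
  qed (auto intro: exI[of _ 1])
  then obtain c where c: "c > 0" "\<And>v. v \<in> S \<Longrightarrow> c \<le> v \<bullet> (X *v v)"
    by blast
  have "c * (norm v)\<^sup>2 \<le> v \<bullet> (X *v v)" if "v \<in> V" for v
  proof (cases "v = 0")
    case False
    have "v /\<^sub>R norm v \<in> S"
      using False that V by (simp add: S_def subspace_scale)
    then have "c \<le> (v \<bullet> (X *v v)) / (norm v)\<^sup>2"
      using c(2)[of "v /\<^sub>R norm v"]
      by (simp add: matrix_vector_mult_scaleR power2_eq_square divide_simps)
    then show ?thesis
      using False by (simp add: field_simps)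
  qed simp
  then show thesis
    using c(1) that by (simp add: V_def)
qed

text \<open>Range and kernel of a symmetric matrix are orthogonal complements. The kernel form suits
  the face property, the range form the dimension count.\<close>

lemma symmetric_mat_range_subset_iff:
  assumes X: "symmetric_mat X" and Y: "symmetric_mat Y"
  shows "range ((*v) Y) \<subseteq> range ((*v) X) \<longleftrightarrow> (\<forall>v. X *v v = 0 \<longrightarrow> Y *v v = 0)"
proof
  assume *: "range ((*v) Y) \<subseteq> range ((*v) X)"
  show "\<forall>v. X *v v = 0 \<longrightarrow> Y *v v = 0"
  proof (intro allI impI)
    fix v assume v: "X *v v = 0"
    obtain w where "Y *v (Y *v v) = X *v w"
      using * by blast
    then have "v \<bullet> (Y *v (Y *v v)) = 0"
      using X v by (simp add: symmetric_mat_iff)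
    then have "(Y *v v) \<bullet> (Y *v v) = 0"
      using Y unfolding symmetric_mat_iff by metis
    then show "Y *v v = 0"
      by simp
  qed
next
  assume *: "\<forall>v. X *v v = 0 \<longrightarrow> Y *v v = 0"
  obtain f where f: "linear f" "\<And>v. f v \<in> range ((*v) X)"
    "\<And>u v. u \<in> range ((*v) X) \<Longrightarrow> u \<bullet> f v = u \<bullet> v"
    using orthogonal_projection_obtain[OF subspace_range_matrix] by metis
  have "Y *v v = f (Y *v v)" for v
  proof -
    \<comment> \<open>The residual \<open>z\<close> is orthogonal to the range of \<open>X\<close>,
      so \<open>X\<close> and hence \<open>Y\<close> kill it; then it is orthogonal to
      \<open>Y *v v\<close> and to its projection, thus to itself.\<close>
    define z where "z = Y *v v - f (Y *v v)"
    have "(X *v u) \<bullet> z = 0" for u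
      by (simp add: z_def inner_diff_right f(3))
    then have "u \<bullet> (X *v z) = 0" for u
      using X by (simp add: symmetric_mat_iff)
    then have Xz: "X *v z = 0"
      by (metis inner_eq_zero_iff)
    then have "Y *v z = 0"
      using * by blast
    then have "z \<bullet> (Y *v v) = 0"
      using Y by (simp add: symmetric_mat_iff)
    moreover have "z \<bullet> f (Y *v v) = 0"
      using f(2)[of "Y *v v"] \<open>\<And>u. (X *v u) \<bullet> z = 0\<close> by (auto simp: inner_commute)
    ultimately have "z \<bullet> z = 0"
      by (metis z_def inner_diff_right diff_self)
    then show ?thesis
      by (simp add: z_def)
  qed
  then show "range ((*v) Y) \<subseteq> range ((*v) X)"
    using f(2) by (metis image_subsetI)
qed

lemma convex_psd: "convex {A. psd A}"
  by (rule convexI)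
    (auto simp: psd_def symmetric_mat_iff matrix_vector_mult_add_rdistrib
      matrix_vector_mult_scaleR_left inner_add_left inner_add_right)

lemma elliptope_C_iff:
  "X \<in> elliptope_C \<longleftrightarrow> psd X \<and> (\<forall>i k l. X $ (i, k) $ (i, l) = (if k = l then 1 else 0))"
  by (auto simp: elliptope_C_def psd_def sbd_eq_iff)

text \<open>The form of \<open>X + H\<close> depends only on the projection of \<open>v\<close> to
  the range of \<open>X\<close>, where \<open>X\<close> is bounded below by \<open>c\<close>; so
  \<open>e = c\<close> works.\<close>

lemma psd_add_small:
  fixes X :: "real ^ 'n ^ 'n"
  assumes X: "psd X"
  obtains e where "e > 0" "\<And>H. H \<in> sym_range (range ((*v) X)) \<Longrightarrow> norm H < e \<Longrightarrow> psd (X + H)"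
proof -
  define V where "V = range ((*v) X)"
  obtain c where c: "c > 0" "\<And>v. v \<in> V \<Longrightarrow> c * (norm v)\<^sup>2 \<le> v \<bullet> (X *v v)"
    using psd_pos_on_range[OF X] unfolding V_def by metis
  have V: "subspace V"
    by (simp add: V_def subspace_range_matrix)
  obtain f where fV: "\<And>v. f v \<in> V" and f: "\<And>u v. u \<in> V \<Longrightarrow> u \<bullet> f v = u \<bullet> v"
    using orthogonal_projection_obtain[OF V] by metis
  have "psd (X + H)" if H: "H \<in> sym_range V" "norm H < c" for H
  proof -
    have X_in: "X \<in> sym_range V"
      using X by (simp add: psd_def sym_range_def V_def)
    have XH: "X + H \<in> sym_range V"
      using X_in H V by (simp add: subspace_add subspace_sym_range)
    have "0 \<le> v \<bullet> ((X + H) *v v)" for v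
    proof -
      have in_V: "(X + H) *v u \<in> V" and sym: "u \<bullet> ((X + H) *v w) = ((X + H) *v u) \<bullet> w" for u w
        using XH unfolding sym_range_def symmetric_mat_iff by blast+
      have "v \<bullet> ((X + H) *v v) = v \<bullet> ((X + H) *v f v)"
        unfolding sym by (rule f[OF in_V, symmetric])
      also have "\<dots> = f v \<bullet> ((X + H) *v f v)"
        using f[OF in_V[of "f v"], of v] by (simp only: inner_commute)
      also have "\<dots> = f v \<bullet> (X *v f v) + f v \<bullet> (H *v f v)"
        by (simp add: matrix_vector_mult_add_rdistrib inner_add_right)
      also have "\<dots> \<ge> c * (norm (f v))\<^sup>2 - c * (norm (f v))\<^sup>2"
      proof -
        have "\<bar>f v \<bullet> (H *v f v)\<bar> \<le> norm (f v) * (norm H * norm (f v))"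
          by (rule order_trans[OF Cauchy_Schwarz_ineq2 mult_left_mono[OF norm_matrix_vector_mult_le]]) simp
        also have "\<dots> \<le> norm (f v) * (c * norm (f v))"
          using H by (intro mult_left_mono mult_right_mono) auto
        finally show ?thesis
          using c(2)[OF fV[of v]] by (simp add: power2_eq_square mult_ac)
      qed
      finally show ?thesis
        by simp
    qed
    then show ?thesis
      using XH by (simp add: psd_def sym_range_def)
  qed
  then show thesis
    using c that unfolding V_def by blast
qed

lemma subspace_face_dir: "subspace (face_dir X)"
  using subspace_sym_range[OF subspace_range_matrix, of X]
  by (auto simp: face_dir_def subspace_def sbd_def vec_eq_iff)

text \<open>The face \<open>F\<close> lies between the affine space \<open>A\<close> and the part of
  \<open>A\<close> in a small ball around \<open>X\<close>, which have the same dimension.\<close>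

lemma aff_dim_face_at:
  fixes X :: "('q::finite, 'd::finite) bmat"
  assumes X: "X \<in> elliptope_C"
  shows "aff_dim (face_at elliptope_C X) = int (dim (face_dir X))"
proof -
  define F where "F = {Y \<in> elliptope_C. \<forall>v. X *v v = 0 \<longrightarrow> Y *v v = 0}"
  define A where "A = (+) X ` face_dir X"
  have XF: "X \<in> F" and psdX: "psd X"
    using X by (auto simp: F_def elliptope_C_iff)
  have "convex F"
    using convex_psd
    by (auto simp: convex_def F_def elliptope_C_iff matrix_vector_mult_add_rdistrib
        matrix_vector_mult_scaleR_left)
  \<comment> \<open>On the kernel of \<open>X\<close> the form of \<open>W\<close> is zero and a
    positive combination of the nonnegative forms of \<open>Y\<close> and \<open>Z\<close>, so these
    vanish too.\<close>
  have "F face_of elliptope_C"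
    unfolding face_of_def
  proof (intro conjI ballI impI)
    fix Y Z W :: "('q, 'd) bmat"
    assume YZ: "Y \<in> elliptope_C" "Z \<in> elliptope_C" and W: "W \<in> F" "W \<in> open_segment Y Z"
    obtain t where t: "0 < t" "t < 1" "W = (1 - t) *\<^sub>R Y + t *\<^sub>R Z"
      using W by (auto simp: in_segment)
    have psd: "psd Y" "psd Z"
      using YZ by (auto simp: elliptope_C_iff)
    have "Y *v v = 0 \<and> Z *v v = 0" if "X *v v = 0" for v
    proof -
      have "W *v v = 0"
        using W that by (simp add: F_def)
      then have "v \<bullet> (W *v v) = 0"
        by simp
      then have "(1 - t) * (v \<bullet> (Y *v v)) + t * (v \<bullet> (Z *v v)) = 0"
        by (simp add: t(3) matrix_vector_mult_add_rdistrib matrix_vector_mult_scaleR_left inner_add_right)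
      moreover have "0 \<le> v \<bullet> (Y *v v)" "0 \<le> v \<bullet> (Z *v v)"
        using psd by (auto simp: psd_def)
      ultimately have "v \<bullet> (Y *v v) = 0" "v \<bullet> (Z *v v) = 0"
        using t by (simp_all add: add_nonneg_eq_0_iff)
      then show ?thesis
        using psd psd_mult_eq_0 by blast
    qed
    then show "Y \<in> F" "Z \<in> F"
      using YZ by (auto simp: F_def)
  qed (use \<open>convex F\<close> in \<open>auto simp: F_def\<close>)
  have A_eq: "Y \<in> A \<longleftrightarrow> Y - X \<in> face_dir X" for Y
    by (force simp: A_def image_iff)
  \<comment> \<open>Within \<open>A\<close> the linear conditions hold already; only
    semidefiniteness remains.\<close>
  have F_eq: "Y \<in> F \<longleftrightarrow> psd Y \<and> Y \<in> A" for Y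
  proof (cases "psd Y")
    case True
    have symX: "symmetric_mat X" and symY: "symmetric_mat Y"
      using True psdX by (auto simp: psd_def)
    have symYX: "symmetric_mat (Y - X)"
      using symX symY
      by (simp add: symmetric_mat_iff matrix_vector_mult_diff_rdistrib inner_diff_left inner_diff_right)
    have "(\<forall>v. X *v v = 0 \<longrightarrow> Y *v v = 0) \<longleftrightarrow> (\<forall>v. X *v v = 0 \<longrightarrow> (Y - X) *v v = 0)"
      by (simp add: matrix_vector_mult_diff_rdistrib)
    also have "\<dots> \<longleftrightarrow> Y - X \<in> sym_range (range ((*v) X))"
      using symmetric_mat_range_subset_iff[OF symX symYX] symYX by (auto simp: sym_range_def)
    finally have "Y \<in> F \<longleftrightarrow> sbd Y = mat 1 \<and> Y - X \<in> sym_range (range ((*v) X))"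
      using True symY by (auto simp: F_def elliptope_C_def)
    also have "sbd Y = mat 1 \<longleftrightarrow> sbd (Y - X) = 0"
    proof -
      have "sbd (Y - X) = sbd Y - sbd X"
        by (simp add: sbd_def vec_eq_iff)
      then show ?thesis
        using X by (simp add: elliptope_C_def)
    qed
    finally show ?thesis
      using True by (auto simp: A_eq face_dir_def)
  qed (auto simp: F_def elliptope_C_iff)
  obtain e where e: "e > 0"
    "\<And>H. H \<in> sym_range (range ((*v) X)) \<Longrightarrow> norm H < e \<Longrightarrow> psd (X + H)"
    using psd_add_small[OF psdX] by metis
  have ball: "A \<inter> ball X e \<subseteq> F"
  proof
    fix Y assume Y: "Y \<in> A \<inter> ball X e"
    then have "psd (X + (Y - X))"
      by (intro e(2)) (auto simp: A_eq face_dir_def dist_norm norm_minus_commute)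
    then show "Y \<in> F"
      using Y by (simp add: F_eq)
  qed
  have "affine A"
    unfolding A_def affine_translation[symmetric] by (rule subspace_imp_affine[OF subspace_face_dir])
  have "F \<subseteq> A"
    by (auto simp: F_eq)
  then have "affine hull F \<subseteq> A"
    by (simp add: hull_minimal \<open>affine A\<close>)
  then have "X \<in> rel_interior F"
    unfolding mem_rel_interior_ball using XF e(1) ball by blast
  \<comment> \<open>Faces whose relative interiors meet coincide, which gives the uniqueness in
    \<open>face_at\<close>.\<close>
  then have face: "face_at elliptope_C X = F"
    unfolding face_at_def using \<open>F face_of elliptope_C\<close> face_of_eq[of _ elliptope_C F]
    by (intro the_equality) blast+
  have "aff_dim A = aff_dim (A \<inter> ball X e)"
    using XF e(1) \<open>F \<subseteq> A\<close> \<open>affine A\<close>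
    by (intro aff_dim_convex_Int_open[symmetric]) (auto simp: affine_imp_convex)
  also have "\<dots> \<le> aff_dim F"
    by (rule aff_dim_subset[OF ball])
  finally have "aff_dim F = aff_dim A"
    using aff_dim_subset[OF \<open>F \<subseteq> A\<close>] by simp
  also have "\<dots> = int (dim (face_dir X))"
    by (simp add: A_def aff_dim_translation_eq aff_dim_subspace subspace_face_dir)
  finally show ?thesis
    by (simp add: face)
qed

subsection \<open>Dimension bounds and the extremal matrices\<close>

text \<open>Both follow from dim L + dim M = p (p + 1) / 2 and the two estimates of dim M, doubled
  and free of subtraction.\<close>

lemma dim_face_dir_bounds:
  fixes X :: "('q::finite, 'd::finite) bmat"
  assumes X: "X \<in> elliptope_C"
  shows "rank X * (rank X + 1) \<le> 2 * dim (face_dir X) + CARD('q) * CARD('d) * (CARD('d) + 1)"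
    and "2 * dim (face_dir X) + rank X * (CARD('d) + 1) \<le> rank X * (rank X + 1)"
proof -
  obtain W :: "'q \<Rightarrow> (real ^ ('q \<times> 'd)) set"
    where W: "\<And>i. subspace (W i)" "\<And>i. dim (W i) = CARD('d)" "span (\<Union>i. W i) = range ((*v) X)"
    "dim (face_dir X) + dim (span (\<Union>i. sym_range (W i))) = dim (sym_range (range ((*v) X)))"
    by (rule face_dir_complement[OF X]) blast
  have "2 * dim (sym_range (range ((*v) X))) = rank X * (rank X + 1)"
    using dim_sym_range[OF subspace_range_matrix, of X] by (simp add: rank_dim_range)
  moreover have "2 * dim (span (\<Union>i. sym_range (W i))) \<le> CARD('q) * (CARD('d) * (CARD('d) + 1))"
    by (rule dim_span_UN_sym_range_le) (simp_all add: W)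
  moreover have "rank X * (CARD('d) + 1) \<le> 2 * dim (span (\<Union>i. sym_range (W i)))"
    using dim_span_UN_sym_range_ge[of UNIV W "CARD('d)"] W by (simp add: rank_dim_range)
  ultimately show "rank X * (rank X + 1) \<le> 2 * dim (face_dir X) + CARD('q) * CARD('d) * (CARD('d) + 1)"
    and "2 * dim (face_dir X) + rank X * (CARD('d) + 1) \<le> rank X * (rank X + 1)"
    using W(4) unfolding mult.assoc by linarith+
qed

text \<open>Sharpens the lower bound: \<open>g\<close> sends each block to one with equal columns,
  so the \<open>W i\<close> with \<open>i\<close> in \<open>range g\<close> already generate
  M.\<close>

lemma dim_face_dir_ge_distinct_blocks:
  fixes X :: "('q::finite, 'd::finite) bmat"
  assumes X: "X \<in> elliptope_C" and g: "\<And>i k. column (g i, k) X = column (i, k) X"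
  shows "rank X * (rank X + 1) \<le> 2 * dim (face_dir X) + card (range g) * CARD('d) * (CARD('d) + 1)"
proof -
  obtain W :: "'q \<Rightarrow> (real ^ ('q \<times> 'd)) set"
    where W: "\<And>i. subspace (W i)" "\<And>i. dim (W i) = CARD('d)"
    "dim (face_dir X) + dim (span (\<Union>i. sym_range (W i))) = dim (sym_range (range ((*v) X)))"
    and eq: "\<And>i j. (\<forall>k. column (i, k) X = column (j, k) X) \<Longrightarrow> W i = W j"
    by (rule face_dir_complement[OF X]) blast
  have "W (g i) = W i" for i
    by (intro eq allI g)
  then have "(\<Union>i. sym_range (W i)) = (\<Union>i\<in>range g. sym_range (W i))"
    by simp
  then have "2 * dim (span (\<Union>i. sym_range (W i))) \<le> card (range g) * (CARD('d) * (CARD('d) + 1))"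
    using dim_span_UN_sym_range_le[of "range g" W "CARD('d)"] W by simp
  moreover have "2 * dim (sym_range (range ((*v) X))) = rank X * (rank X + 1)"
    using dim_sym_range[OF subspace_range_matrix, of X] by (simp add: rank_dim_range)
  ultimately show ?thesis
    using W(3) unfolding mult.assoc by linarith
qed

text \<open>The partition of the block indices is encoded by the fibres of \<open>g\<close>.\<close>

definition block_merge :: "('q \<Rightarrow> 'q) \<Rightarrow> ('q::finite, 'd::finite) bmat" where
  "block_merge g = (\<chi> a b. if snd a = snd b \<and> g (fst a) = g (fst b) then 1 else 0)"

lemma block_merge_in_elliptope: "block_merge g \<in> elliptope_C"
proof -
  have "symmetric_mat (block_merge g)"
    by (auto simp: symmetric_mat_def block_merge_def transpose_def vec_eq_iff)
  moreover have "0 \<le> v \<bullet> (block_merge g *v v)" for v :: "real ^ ('a \<times> 'b)"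
  proof -
    let ?h = "\<lambda>a :: 'a \<times> 'b. (g (fst a), snd a)"
    \<comment> \<open>A factorization B B^T, where row \<open>a\<close> of B is the unit vector at
      \<open>?h a\<close>; the form becomes a sum of squares.\<close>
    have "block_merge g $ a $ b = (\<Sum>c\<in>UNIV. of_bool (?h a = c) * of_bool (?h b = c))" for a b
    proof -
      have "(\<Sum>c\<in>UNIV. of_bool (?h a = c) * of_bool (?h b = c)) = (\<Sum>c\<in>UNIV. if c = ?h a then of_bool (?h b = c) else 0 :: real)"
        by (intro sum.cong) auto
      then show ?thesis
        by (auto simp: block_merge_def)
    qed
    then have "v \<bullet> (block_merge g *v v)
        = (\<Sum>a\<in>UNIV. \<Sum>b\<in>UNIV. \<Sum>c\<in>UNIV. (v $ a * of_bool (?h a = c)) * (v $ b * of_bool (?h b = c)))"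
      unfolding inner_matrix_vector
      by (intro sum.cong refl) (simp only: sum_distrib_left sum_distrib_right mult_ac)
    also have "\<dots> = (\<Sum>a\<in>UNIV. \<Sum>c\<in>UNIV. \<Sum>b\<in>UNIV. (v $ a * of_bool (?h a = c)) * (v $ b * of_bool (?h b = c)))"
      by (intro sum.cong refl sum.swap)
    also have "\<dots> = (\<Sum>c\<in>UNIV. \<Sum>a\<in>UNIV. \<Sum>b\<in>UNIV. (v $ a * of_bool (?h a = c)) * (v $ b * of_bool (?h b = c)))"
      by (rule sum.swap)
    also have "\<dots> = (\<Sum>c\<in>UNIV. (\<Sum>a\<in>UNIV. v $ a * of_bool (?h a = c))\<^sup>2)"
      by (simp only: sum_product power2_eq_square)
    finally show ?thesis
      by (simp add: sum_nonneg)
  qed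
  ultimately show ?thesis
    by (auto simp: elliptope_C_iff psd_def block_merge_def)
qed

text \<open>Idempotence makes \<open>range g\<close> a set of class representatives. Their columns
  exhaust all columns, are nonzero and have disjoint supports.\<close>

lemma rank_block_merge:
  fixes g :: "'q::finite \<Rightarrow> 'q"
  assumes g: "\<And>i. g (g i) = g i"
  shows "rank (block_merge g :: ('q, 'd::finite) bmat) = card (range g) * CARD('d)"
proof -
  let ?X = "block_merge g :: ('q, 'd) bmat"
  let ?I = "range g \<times> (UNIV :: 'd set)"
  define y where "y a = column a ?X" for a
  have y: "y a $ c = (if snd c = snd a \<and> g (fst c) = g (fst a) then 1 else 0)" for a c
    by (simp add: y_def column_def block_merge_def)
  have y_self: "y a $ a = 1" for a
    by (simp add: y)
  have "columns ?X = range y"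
    by (auto simp: columns_def y_def)
  moreover have "range y \<subseteq> y ` ?I"
  proof (rule image_subsetI)
    fix a
    have "y a = y (g (fst a), snd a)"
      by (simp add: vec_eq_iff y g)
    then show "y a \<in> y ` ?I"
      by (rule image_eqI) simp
  qed
  then have "range y = y ` ?I"
    by blast
  ultimately have cols: "columns ?X = y ` ?I"
    by simp
  have orth: "orthogonal (y a) (y b)" if "a \<in> ?I" "b \<in> ?I" "a \<noteq> b" for a b
  proof -
    have "g (fst a) = fst a" "g (fst b) = fst b"
      using that g by auto
    then have "y a $ c * y b $ c = 0" for c
      using that(3) by (auto simp: y prod_eq_iff)
    then show ?thesis
      by (auto simp: orthogonal_def inner_vec_def intro!: sum.neutral)
  qed
  have nz: "y a \<noteq> 0" for a
    using y_self[of a] by auto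
  have "inj_on y ?I"
    by (rule inj_onI) (metis orth nz orthogonal_self)
  moreover have "independent (y ` ?I)"
  proof (rule pairwise_orthogonal_independent)
    show "pairwise orthogonal (y ` ?I)"
      by (rule pairwise_imageI) (rule orth)
    show "0 \<notin> y ` ?I"
      by (metis imageE nz)
  qed
  ultimately have "dim (y ` ?I) = card ?I"
    by (simp add: dim_eq_card_independent card_image)
  then show ?thesis
    unfolding column_rank_def cols by (simp add: card_cartesian_product)
qed

lemma idempotent_with_range_obtain:
  assumes "0 < m" "m \<le> CARD('q::finite)"
  obtains g :: "'q::finite \<Rightarrow> 'q" where "\<And>i. g (g i) = g i" "card (range g) = m"
proof -
  obtain R :: "'q set" where R: "card R = m"
    using obtain_subset_with_card_n[OF assms(2)] by blast
  then obtain r where r: "r \<in> R"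
    using assms(1) by fastforce
  \<comment> \<open>A retraction onto \<open>R\<close>; a positive \<open>m\<close> provides the
    point \<open>r\<close> that receives all other indices.\<close>
  have "range (\<lambda>i. if i \<in> R then i else r) = R"
    using r by auto
  then show thesis
    using that[of "\<lambda>i. if i \<in> R then i else r"] R r by auto
qed

text \<open>The condition \<open>d \<le> p \<le> q * d\<close> in the second part excludes no rank
  that occurs: the range of a member contains the \<open>d\<close>-dimensional spaces
  \<open>W i\<close>.\<close>

theorem theorem6:
  fixes q d :: nat
  assumes "CARD('q::finite) = q" and "CARD('d::finite) = d"
  shows "(\<forall>X \<in> (elliptope_C :: ('q, 'd) bmat set).
            let p = real (rank X); F = face_at elliptope_C X in
              p * (p + 1) / 2 - real (q * d) * (real d + 1) / 2 \<le> real_of_int (aff_dim F)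
            \<and> real_of_int (aff_dim F) \<le> p * (p + 1) / 2 - p * (real d + 1) / 2)
       \<and> (\<forall>p::nat. d dvd p \<and> d \<le> p \<and> p \<le> q * d \<longrightarrow>
            (\<exists>X \<in> (elliptope_C :: ('q, 'd) bmat set). rank X = p \<and>
               real_of_int (aff_dim (face_at elliptope_C X))
                 = real p * (real p + 1) / 2 - real p * (real d + 1) / 2))"
proof (intro conjI ballI allI impI)
  fix X :: "('q, 'd) bmat" assume X: "X \<in> elliptope_C"
  have b: "real (rank X) * (real (rank X) + 1) \<le> 2 * real (dim (face_dir X)) + real (q * d) * (real d + 1)"
    "2 * real (dim (face_dir X)) + real (rank X) * (real d + 1) \<le> real (rank X) * (real (rank X) + 1)"
    using dim_face_dir_bounds[OF X] unfolding assms of_nat_le_iff[where 'a = real, symmetric]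
    by (simp_all add: algebra_simps)
  show "let p = real (rank X); F = face_at elliptope_C X in
              p * (p + 1) / 2 - real (q * d) * (real d + 1) / 2 \<le> real_of_int (aff_dim F)
            \<and> real_of_int (aff_dim F) \<le> p * (p + 1) / 2 - p * (real d + 1) / 2"
    using b by (simp add: Let_def aff_dim_face_at[OF X])
next
  fix p :: nat assume p: "d dvd p \<and> d \<le> p \<and> p \<le> q * d"
  have "0 < d"
    by (simp flip: assms)
  obtain m where m: "p = m * d"
    using p by (metis dvd_div_mult_self)
  have "0 < m"
    using p m \<open>0 < d\<close> by (cases m) auto
  have "m \<le> CARD('q)"
    using p m \<open>0 < d\<close> assms(1) by simp
  obtain g :: "'q \<Rightarrow> 'q" where g: "\<And>i. g (g i) = g i" "card (range g) = m"
    using idempotent_with_range_obtain[OF \<open>0 < m\<close> \<open>m \<le> CARD('q)\<close>] by blast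
  let ?X = "block_merge g :: ('q, 'd) bmat"
  have X: "?X \<in> elliptope_C"
    by (rule block_merge_in_elliptope)
  have r: "rank ?X = p"
    using rank_block_merge[of g, where 'd = 'd] g by (simp add: m assms)
  have "column (g i, k) ?X = column (i, k) ?X" for i k
    by (simp add: column_def block_merge_def vec_eq_iff g)
  \<comment> \<open>With \<open>m\<close> representatives the sharpened lower bound subtracts
    \<open>m * d * (d + 1) = p * (d + 1)\<close> and so meets the upper bound.\<close>
  from dim_face_dir_ge_distinct_blocks[OF X this] dim_face_dir_bounds(2)[OF X]
  have "2 * dim (face_dir ?X) + p * (d + 1) = p * (p + 1)"
    unfolding r g(2) assms mult.assoc[symmetric] m[symmetric] by linarith
  then have "2 * real (dim (face_dir ?X)) + real p * (real d + 1) = real p * (real p + 1)"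
    unfolding of_nat_eq_iff[where 'a = real, symmetric] by (simp add: algebra_simps)
  then have "real_of_int (aff_dim (face_at elliptope_C ?X)) = real p * (real p + 1) / 2 - real p * (real d + 1) / 2"
    by (simp add: aff_dim_face_at[OF X] field_simps)
  with X r show "\<exists>X \<in> (elliptope_C :: ('q, 'd) bmat set). rank X = p \<and>
               real_of_int (aff_dim (face_at elliptope_C X))
                 = real p * (real p + 1) / 2 - real p * (real d + 1) / 2"
    by blast
qed

end
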